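(* Let $d\ge2$, let $O_-\subset D_0\subset\mathbb{R}^d$ be open sets with $D_0$ bounded. Let $\{D_t\}_{t\ge0}$ be the open evolution of $V=-\kappa$ (i.e. $\nu=0$) with initial set $D_0$ and obstacles $O_-$ and $O_+=\mathbb{R}^d$, and let $\{E_t\}_{t\ge0}$ be the closed evolution of $V=-\kappa$ with initial set $E_0=\overline{D_0}$ and obstacles $C_-=\overline{O_-}$ and $C_+=\mathbb{R}^d$. Assume that there exists $r>0$ such that for every $w\in\partial O_-$ there exists $z\in B_r(w)$ with $O_-\subset B_{|z-w|}(z)$. Then $$\lim_{t\to\infty}D_t=O_-\quad\text{and}\quad\lim_{t\to\infty}E_t=C_-.$$ Moreover there exists $\tau>0$ such that $D_t=D_\tau=O_-$ and $E_t=E_\tau=C_-$ for all $t\ge\tau$.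
   Context: $B_r(z)$ is the open ball of radius $r$ centered at $z$. For a family of sets, $\varlimsup_{t\to\infty}D_t:=\bigcap_{\tau>0}\bigcup_{t>\tau}D_t$ and $\varliminf_{t\to\infty}D_t:=\bigcup_{\tau>0}\bigcap_{t>\tau}D_t$; if they coincide the common set is $\lim_{t\to\infty}D_t$. Let $\mathbb{S}^d$ be the real symmetric $d\times d$ matrices, and $F(p,X)=-\mathrm{Tr}\big((I-\frac{p\otimes p}{|p|^2})X\big)$ for $p\in\mathbb{R}^d\setminus\{0\}$, $X\in\mathbb{S}^d$. Upper and lower stars denote upper and lower semicontinuous envelopes. For $\nu\in\mathbb{R}$, Lipschitz functions $\Psi_-\le\Psi_+$ on $\mathbb{R}^d$ and $u_0\in C(\mathbb{R}^d)$, consider the obstacle problem (P): $u_t-\nu|Du|+F(Du,D^2u)=0$ in $\mathbb{R}^d\times(0,\infty)$, $u(\cdot,0)=u_0$, $\Psi_-(x)\le u(x,t)\le\Psi_+(x)$ in $\mathbb{R}^d\times(0,\infty)$. $u$ is a viscosity subsolution of (P) if (a) $\Psi_-(x)\le u^*(x,t)\le\Psi_+(x)$ for all $(x,t)\in\mathbb{R}^d\times(0,\infty)$; (b) $u^*(x,0)\le u_0(x)$ for all $x$; (c) whenever $\phi$ is smooth, $u^*-\phi$ has a local maximum at $(x_0,t_0)\in\mathbb{R}^d\times(0,\infty)$ and $u^*(x_0,t_0)>\Psi_-(x_0)$, one has $\phi_t-\nu|D\phi|+F_*(D\phi,D^2\phi)\le0$ at $(x_0,t_0)$. $u$ is a viscosity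 supersolution if (a) $\Psi_-(x)\le u_*(x,t)\le\Psi_+(x)$ for all $(x,t)\in\mathbb{R}^d\times(0,\infty)$; (b) $u_*(x,0)\ge u_0(x)$ for all $x$; (c) whenever $\phi$ is smooth, $u_*-\phi$ has a local minimum at $(x_0,t_0)\in\mathbb{R}^d\times(0,\infty)$ and $u_*(x_0,t_0)<\Psi_+(x_0)$, one has $\phi_t-\nu|D\phi|+F^*(D\phi,D^2\phi)\ge0$ at $(x_0,t_0)$. A viscosity solution is both. For a constant $a<0$ let $K_a(\mathbb{R}^d\times[0,\infty))$ be the set of $u\in C(\mathbb{R}^d\times[0,\infty))$ such that for all $T>0$ there is $R>0$ with $u=a$ on $\{|x|\ge R\}\times[0,T]$. Open evolution: for open sets $D_0,O_-,O_+$, a family of open sets $\{D_t\}_{t\ge0}$ is the open evolution of $V=-\kappa+\nu$ with initial set $D_0$ and obstacles $O_-,O_+$ ($O_-\subset D_t\subset O_+$) if there exist Lipschitz $\Psi_\pm$, $u_0\in C(\mathbb{R}^d)$ and a viscosity solution $u\in K_a(\mathbb{R}^d\times[0,\infty))$ of (P) such that $O_\pm=\{\Psi_\pm>0\}$ and $D_t=\{x\mid u(x,t)>0\}$ for all $t\ge0$. Closed evolution: for closed sets $E_0,C_-,C_+$, the family of closed sets $\{E_t\}_{t\ge0}$ is defined in the same way with $C_\pm=\{\Psi_\pm\ge0\}$ and $E_t=\{x\mid u(x,t)\ge0\}$ for all $t\ge0$. Open and closed evolutions exist and are unique (known result). *)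

theory Defs
  imports "HOL-Analysis.Analysis"
begin

section \<open>Limits of families of sets\<close>

definition set_limsup :: "(real \<Rightarrow> 'a set) \<Rightarrow> 'a set" where
  "set_limsup D = (\<Inter>\<tau>\<in>{0<..}. \<Union>t\<in>{\<tau><..}. D t)"

definition set_liminf :: "(real \<Rightarrow> 'a set) \<Rightarrow> 'a set" where
  "set_liminf D = (\<Union>\<tau>\<in>{0<..}. \<Inter>t\<in>{\<tau><..}. D t)"

definition has_set_limit :: "(real \<Rightarrow> 'a set) \<Rightarrow> 'a set \<Rightarrow> bool" where
  "has_set_limit D L \<longleftrightarrow> set_limsup D = L \<and> set_liminf D = L"


section \<open>Semicontinuous envelopes\<close>

text \<open>
  Envelopes of a real function \<open>f\<close> with domain \<open>S\<close>, evaluated at points of the closure of \<open>S\<close>.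
  The filter is that of the sets \<open>U \<inter> S\<close> with \<open>U\<close> a neighbourhood of \<open>p\<close>, and it
  includes \<open>p\<close> itself when \<open>p \<in> S\<close> (unlike \<open>at p within S\<close>); so the upper envelope at \<open>p\<close> is the
  limit as \<open>\<epsilon> \<rightarrow> 0\<close> of the supremum of \<open>f\<close> over \<open>S \<inter> ball p \<epsilon>\<close>. Values are extended reals
  because \<open>f\<close> need not be locally bounded.
\<close>

definition usc_env :: "'a::topological_space set \<Rightarrow> ('a \<Rightarrow> real) \<Rightarrow> 'a \<Rightarrow> ereal" where
  "usc_env S f p = Limsup (inf (nhds p) (principal S)) (\<lambda>q. ereal (f q))"

definition lsc_env :: "'a::topological_space set \<Rightarrow> ('a \<Rightarrow> real) \<Rightarrow> 'a \<Rightarrow> ereal" where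
  "lsc_env S f p = Liminf (inf (nhds p) (principal S)) (\<lambda>q. ereal (f q))"


section \<open>Smooth functions and their derivatives\<close>

definition dir_deriv :: "'a::real_normed_vector \<Rightarrow> ('a \<Rightarrow> real) \<Rightarrow> 'a \<Rightarrow> real" where
  "dir_deriv v f p = frechet_derivative f (at p) v"

text \<open>Meant for open \<open>S\<close>: all iterated directional derivatives up to order \<open>k\<close> are continuous.\<close>

fun Ck_on :: "nat \<Rightarrow> 'a::euclidean_space set \<Rightarrow> ('a \<Rightarrow> real) \<Rightarrow> bool" where
  "Ck_on 0 S f \<longleftrightarrow> continuous_on S f"
| "Ck_on (Suc k) S f \<longleftrightarrow>
     (\<forall>p\<in>S. f differentiable (at p)) \<and> (\<forall>v. Ck_on k S (dir_deriv v f))"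

definition smooth_on :: "'a::euclidean_space set \<Rightarrow> ('a \<Rightarrow> real) \<Rightarrow> bool" where
  "smooth_on S f \<longleftrightarrow> (\<forall>k. Ck_on k S f)"

text \<open>
  Points of space-time are pairs \<open>(x, t)\<close>; \<open>D\<close> and \<open>D\<^sup>2\<close> are the gradient and
  the Hessian in the space variable only.
\<close>

definition time_deriv :: "((real^'n) \<times> real \<Rightarrow> real) \<Rightarrow> (real^'n) \<times> real \<Rightarrow> real" where
  "time_deriv \<phi> p = dir_deriv (0, 1) \<phi> p"

definition space_grad :: "((real^'n) \<times> real \<Rightarrow> real) \<Rightarrow> (real^'n) \<times> real \<Rightarrow> real^'n" where
  "space_grad \<phi> p = (\<chi> i. dir_deriv (axis i 1, 0) \<phi> p)"

definition space_hess :: "((real^'n) \<times> real \<Rightarrow> real) \<Rightarrow> (real^'n) \<times> real \<Rightarrow> real^'n^'n" where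
  "space_hess \<phi> p = (\<chi> i j. dir_deriv (axis i 1, 0) (dir_deriv (axis j 1, 0) \<phi>) p)"


section \<open>The curvature operator\<close>

definition tensor :: "real^'n \<Rightarrow> real^'n \<Rightarrow> real^'n^'n" where
  "tensor p q = (\<chi> i j. p $ i * q $ j)"

definition F_op :: "(real^'n) \<times> (real^'n^'n) \<Rightarrow> real" where
  "F_op = (\<lambda>(p, X). - trace ((mat 1 - (1 / (norm p)\<^sup>2) *\<^sub>R tensor p p) ** X))"

definition F_dom :: "((real^'n) \<times> (real^'n^'n)) set" where
  "F_dom = {(p, X). p \<noteq> 0 \<and> transpose X = X}"

definition F_lower :: "real^'n \<Rightarrow> real^'n^'n \<Rightarrow> ereal" where
  "F_lower p X = lsc_env F_dom F_op (p, X)"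

definition F_upper :: "real^'n \<Rightarrow> real^'n^'n \<Rightarrow> ereal" where
  "F_upper p X = usc_env F_dom F_op (p, X)"


section \<open>Viscosity solutions of the obstacle problem\<close>

text \<open>
  A function on \<open>\<real>\<^sup>d \<times> [0,\<infinity>)\<close> is a total function of which only the values on
  \<open>space_time\<close> matter; in particular its envelopes at time \<open>0\<close> are taken relative to \<open>space_time\<close>.
\<close>

definition space_time :: "((real^'n) \<times> real) set" where
  "space_time = UNIV \<times> {0..}"

definition pos_time :: "((real^'n) \<times> real) set" where
  "pos_time = UNIV \<times> {0<..}"

definition viscosity_subsolution ::
  "real \<Rightarrow> (real^'n \<Rightarrow> real) \<Rightarrow> (real^'n \<Rightarrow> real) \<Rightarrow> (real^'n \<Rightarrow> real)
     \<Rightarrow> ((real^'n) \<times> real \<Rightarrow> real) \<Rightarrow> bool" where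
  "viscosity_subsolution \<nu> \<Psi>m \<Psi>p u0 u \<longleftrightarrow>
     (let us = usc_env space_time u in
       (\<forall>x t. t > 0 \<longrightarrow> ereal (\<Psi>m x) \<le> us (x, t) \<and> us (x, t) \<le> ereal (\<Psi>p x)) \<and>
       (\<forall>x. us (x, 0) \<le> ereal (u0 x)) \<and>
       (\<forall>\<phi> x0 t0.
          smooth_on pos_time \<phi> \<and> t0 > 0 \<and>
          (\<forall>\<^sub>F q in nhds (x0, t0). us q - ereal (\<phi> q) \<le> us (x0, t0) - ereal (\<phi> (x0, t0))) \<and>
          us (x0, t0) > ereal (\<Psi>m x0) \<longrightarrow>
          ereal (time_deriv \<phi> (x0, t0) - \<nu> * norm (space_grad \<phi> (x0, t0)))
            + F_lower (space_grad \<phi> (x0, t0)) (space_hess \<phi> (x0, t0)) \<le> 0))"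

definition viscosity_supersolution ::
  "real \<Rightarrow> (real^'n \<Rightarrow> real) \<Rightarrow> (real^'n \<Rightarrow> real) \<Rightarrow> (real^'n \<Rightarrow> real)
     \<Rightarrow> ((real^'n) \<times> real \<Rightarrow> real) \<Rightarrow> bool" where
  "viscosity_supersolution \<nu> \<Psi>m \<Psi>p u0 u \<longleftrightarrow>
     (let us = lsc_env space_time u in
       (\<forall>x t. t > 0 \<longrightarrow> ereal (\<Psi>m x) \<le> us (x, t) \<and> us (x, t) \<le> ereal (\<Psi>p x)) \<and>
       (\<forall>x. us (x, 0) \<ge> ereal (u0 x)) \<and>
       (\<forall>\<phi> x0 t0.
          smooth_on pos_time \<phi> \<and> t0 > 0 \<and>
          (\<forall>\<^sub>F q in nhds (x0, t0). us q - ereal (\<phi> q) \<ge> us (x0, t0) - ereal (\<phi> (x0, t0))) \<and>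
          us (x0, t0) < ereal (\<Psi>p x0) \<longrightarrow>
          ereal (time_deriv \<phi> (x0, t0) - \<nu> * norm (space_grad \<phi> (x0, t0)))
            + F_upper (space_grad \<phi> (x0, t0)) (space_hess \<phi> (x0, t0)) \<ge> 0))"

definition viscosity_solution ::
  "real \<Rightarrow> (real^'n \<Rightarrow> real) \<Rightarrow> (real^'n \<Rightarrow> real) \<Rightarrow> (real^'n \<Rightarrow> real)
     \<Rightarrow> ((real^'n) \<times> real \<Rightarrow> real) \<Rightarrow> bool" where
  "viscosity_solution \<nu> \<Psi>m \<Psi>p u0 u \<longleftrightarrow>
     viscosity_subsolution \<nu> \<Psi>m \<Psi>p u0 u \<and> viscosity_supersolution \<nu> \<Psi>m \<Psi>p u0 u"

definition K_class :: "real \<Rightarrow> ((real^'n) \<times> real \<Rightarrow> real) set" where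
  "K_class a = {u. continuous_on space_time u \<and>
     (\<forall>T>0. \<exists>R>0. \<forall>x t. norm x \<ge> R \<and> t \<in> {0..T} \<longrightarrow> u (x, t) = a)}"


section \<open>Open and closed evolutions of \<open>V = -\<kappa> + \<nu>\<close>\<close>

text \<open>
  The data that both kinds of evolution require, with the constant \<open>a < 0\<close> quantified
  existentially. Multiplying \<open>\<Psi>m\<close>, \<open>\<Psi>p\<close>, \<open>u0\<close> and \<open>u\<close> by one constant \<open>c > 0\<close> gives data of
  the same kind with \<open>c a\<close> in place of \<open>a\<close> and the same level sets, so no evolution depends on
  the choice of \<open>a\<close>.
\<close>

definition level_set_data ::
  "real \<Rightarrow> (real^'n \<Rightarrow> real) \<Rightarrow> (real^'n \<Rightarrow> real) \<Rightarrow> ((real^'n) \<times> real \<Rightarrow> real) \<Rightarrow> bool" where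
  "level_set_data \<nu> \<Psi>m \<Psi>p u \<longleftrightarrow>
     (\<exists>L. L-lipschitz_on UNIV \<Psi>m) \<and> (\<exists>L. L-lipschitz_on UNIV \<Psi>p) \<and> (\<forall>x. \<Psi>m x \<le> \<Psi>p x) \<and>
     (\<exists>a<0. u \<in> K_class a) \<and>
     (\<exists>u0. continuous_on UNIV u0 \<and> viscosity_solution \<nu> \<Psi>m \<Psi>p u0 u)"

definition open_evolution ::
  "real \<Rightarrow> (real^'n) set \<Rightarrow> (real^'n) set \<Rightarrow> (real^'n) set \<Rightarrow> (real \<Rightarrow> (real^'n) set) \<Rightarrow> bool" where
  "open_evolution \<nu> D0 Om Op D \<longleftrightarrow>
     open D0 \<and> open Om \<and> open Op \<and> D 0 = D0 \<and>
     (\<forall>t\<ge>0. open (D t) \<and> Om \<subseteq> D t \<and> D t \<subseteq> Op) \<and>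
     (\<exists>\<Psi>m \<Psi>p u. level_set_data \<nu> \<Psi>m \<Psi>p u \<and>
        Om = {x. \<Psi>m x > 0} \<and> Op = {x. \<Psi>p x > 0} \<and>
        (\<forall>t\<ge>0. D t = {x. u (x, t) > 0}))"

definition closed_evolution ::
  "real \<Rightarrow> (real^'n) set \<Rightarrow> (real^'n) set \<Rightarrow> (real^'n) set \<Rightarrow> (real \<Rightarrow> (real^'n) set) \<Rightarrow> bool" where
  "closed_evolution \<nu> E0 Cm Cp E \<longleftrightarrow>
     closed E0 \<and> closed Cm \<and> closed Cp \<and> E 0 = E0 \<and>
     (\<forall>t\<ge>0. closed (E t) \<and> Cm \<subseteq> E t \<and> E t \<subseteq> Cp) \<and>
     (\<exists>\<Psi>m \<Psi>p u. level_set_data \<nu> \<Psi>m \<Psi>p u \<and>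
        Cm = {x. \<Psi>m x \<ge> 0} \<and> Cp = {x. \<Psi>p x \<ge> 0} \<and>
        (\<forall>t\<ge>0. E t = {x. u (x, t) \<ge> 0}))"

end

theory Submission
  imports Defs
begin

text \<open>
  Balls shrinking by curvature drive the evolution onto the obstacle. In dimension \<open>d\<close> the squared
  radius of a ball moving by \<open>V = -\<kappa>\<close> decreases at the constant rate \<open>2 (d - 1)\<close>. Take a ball with
  centre \<open>z\<close> that contains the initial set, and let its squared radius \<open>A - \<alpha> t\<close> decrease at a rate
  \<open>\<alpha> \<le> 2 (d - 1)\<close>. As long as the ball contains the obstacle, the evolution cannot leave it
  (\<open>superlevel_set_in_shrinking_ball\<close>). At any prescribed large time the ball
  can be made arbitrarily close to a given concentric ball around the obstacle.

  The frontier condition says that the obstacle is an intersection of balls of radius less than \<open>r\<close>: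
  a segment from \<open>O\<^sub>-\<close> to a point \<open>x\<close> outside its closure meets the frontier in a point \<open>w\<close>, and the
  ball that belongs to \<open>w\<close> contains the first end of the segment and has \<open>w\<close> on its boundary, so \<open>x\<close>
  is strictly outside (\<open>separating_ball\<close>). The centre of this ball stays within distance \<open>r\<close> of
  \<open>O\<^sub>-\<close>, so one initial radius serves for every \<open>x\<close>, and the time after which \<open>x\<close> is left by the
  evolution is bounded independently of \<open>x\<close>. An empty obstacle fits the same scheme: the squared radius
  is then allowed to become negative, and the evolution becomes extinct.

  The containment in shrinking balls needs no comparison principle between semicontinuous
  solutions, because the supersolution can be chosen smooth. With \<open>s = A - \<alpha> t - |x - z|\<^sup>2\<close>, the barrier is
  \<open>\<theta> + exp (k s) + exp (k (t - t1))\<close>. Up to a positive factor, the curvature operator does not see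
  the composition of \<open>s\<close> with the exponential, so the first exponential is a supersolution. The
  second one makes the inequality strict and, being huge at the final time, keeps a maximum of
  \<open>u\<close> minus the barrier away from the final time. As \<open>k \<rightarrow> \<infinity>\<close>, the barrier tends to \<open>\<theta>\<close> where \<open>s < 0\<close>
  and \<open>t < t1\<close>, and this gives \<open>u \<le> \<theta>\<close> there.

  For the open evolution \<open>\<theta> = 0\<close> yields \<open>D\<^sub>t \<subseteq> closure O\<^sub>-\<close>; as \<open>D\<^sub>t\<close> is open and
  \<open>O\<^sub>-\<close> is the interior of its closure (\<open>interior_closure_eq\<close>), \<open>D\<^sub>t = O\<^sub>-\<close>. For the closed
  evolution one needs \<open>u < 0\<close> outside the obstacle, hence a level \<open>\<theta> < 0\<close>. It exists by compactness,
  since the functions involved are at most \<open>a < 0\<close> near infinity (\<open>negative_gap\<close>).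
\<close>

section \<open>Calculus of smooth functions\<close>

lemma dir_deriv_eq:
  assumes "(f has_derivative f') (at p)"
  shows "dir_deriv v f p = f' v"
  unfolding dir_deriv_def using frechet_derivative_at[OF assms] by simp

lemma Ck_on_SucD: "Ck_on (Suc k) S f \<Longrightarrow> Ck_on k S f"
proof (induction k arbitrary: f)
  case 0
  then show ?case
    by (simp add: continuous_at_imp_continuous_on differentiable_imp_continuous_within)
next
  case (Suc k)
  from Suc.prems show ?case
    by (subst Ck_on.simps(2)) (use Suc.IH in \<open>metis Ck_on.simps(2)\<close>)
qed

lemma Ck_on_subset: "Ck_on k S f \<Longrightarrow> T \<subseteq> S \<Longrightarrow> Ck_on k T f"
  by (induction k arbitrary: f) (auto intro: continuous_on_subset)

lemma smooth_on_subset: "smooth_on S f \<Longrightarrow> T \<subseteq> S \<Longrightarrow> smooth_on T f"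
  by (auto simp: smooth_on_def intro: Ck_on_subset)

lemma smooth_on_imp_continuous_on: "smooth_on S f \<Longrightarrow> continuous_on S f"
  unfolding smooth_on_def by (metis Ck_on.simps(1))

lemma Ck_on_const: "Ck_on k (UNIV :: 'a::euclidean_space set) (\<lambda>_. c)"
proof (induction k arbitrary: c)
  case (Suc k)
  have "dir_deriv v (\<lambda>_. c) = (\<lambda>_. 0)" for v :: 'a
    by (rule ext, subst dir_deriv_eq[OF has_derivative_const]) simp
  with Suc show ?case by simp
qed simp

lemma Ck_on_add: "Ck_on k UNIV f \<Longrightarrow> Ck_on k UNIV g \<Longrightarrow> Ck_on k UNIV (\<lambda>x. f x + g x)"
proof (induction k arbitrary: f g)
  case (Suc k)
  have "dir_deriv v (\<lambda>x. f x + g x) = (\<lambda>x. dir_deriv v f x + dir_deriv v g x)" for v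
    using Suc.prems
    by (intro ext, subst dir_deriv_eq[OF has_derivative_add])
       (auto simp: dir_deriv_def frechet_derivative_works)
  with Suc show ?case by simp
qed (auto intro: continuous_intros)

lemma Ck_on_mult: "Ck_on k UNIV f \<Longrightarrow> Ck_on k UNIV g \<Longrightarrow> Ck_on k UNIV (\<lambda>x. f x * g x)"
proof (induction k arbitrary: f g)
  case (Suc k)
  have "dir_deriv v (\<lambda>x. f x * g x) = (\<lambda>x. f x * dir_deriv v g x + dir_deriv v f x * g x)" for v
    using Suc.prems
    by (intro ext, subst dir_deriv_eq[OF has_derivative_mult])
       (auto simp: dir_deriv_def frechet_derivative_works)
  with Suc Ck_on_SucD[OF Suc.prems(1)] Ck_on_SucD[OF Suc.prems(2)] show ?case
    by (simp add: Ck_on_add)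
qed (auto intro: continuous_intros)

lemma Ck_on_exp: "Ck_on k UNIV f \<Longrightarrow> Ck_on k UNIV (\<lambda>x. exp (f x))"
proof (induction k arbitrary: f)
  case (Suc k)
  have der: "((\<lambda>x. exp (f x)) has_derivative (\<lambda>v. exp (f p) * dir_deriv v f p)) (at p)" for p
    using Suc.prems
    by (auto intro!: derivative_eq_intros simp: dir_deriv_def frechet_derivative_works)
  have "dir_deriv v (\<lambda>x. exp (f x)) = (\<lambda>x. exp (f x) * dir_deriv v f x)" for v
    by (rule ext, rule dir_deriv_eq[OF der])
  with Suc Ck_on_SucD[OF Suc.prems] der show ?case
    by (auto simp: Ck_on_mult differentiable_def)
qed (auto intro: continuous_intros)

lemma Ck_on_linear: "bounded_linear f \<Longrightarrow> Ck_on k UNIV f"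
proof (cases k)
  case 0
  assume "bounded_linear f"
  with 0 show ?thesis by (simp add: linear_continuous_on)
next
  case (Suc j)
  assume f: "bounded_linear f"
  then have der: "(f has_derivative f) (at p)" for p
    by (rule bounded_linear_imp_has_derivative)
  then have "dir_deriv v f = (\<lambda>_. f v)" for v
    by (intro ext dir_deriv_eq)
  with Suc der show ?thesis
    by (auto simp: Ck_on_const differentiable_def)
qed

lemma Ck_on_norm_square:
  fixes f :: "'a::euclidean_space \<Rightarrow> 'b::real_inner"
  assumes f: "bounded_linear f"
  shows "Ck_on k UNIV (\<lambda>x. (f x - z) \<bullet> (f x - z))"
proof (cases k)
  case 0
  then show ?thesis by (auto intro!: continuous_on_inner continuous_on_diff continuous_on_const linear_continuous_on[OF f])
next
  case (Suc j)
  have der: "((\<lambda>x. (f x - z) \<bullet> (f x - z)) has_derivative (\<lambda>v. 2 * (f v \<bullet> f p) + - (2 * (f v \<bullet> z)))) (at p)" for p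
    by (auto intro!: derivative_eq_intros bounded_linear_imp_has_derivative f
        simp: inner_commute algebra_simps)
  have "dir_deriv v (\<lambda>x. (f x - z) \<bullet> (f x - z)) = (\<lambda>p. 2 * (f v \<bullet> f p) + - (2 * (f v \<bullet> z)))" for v
    by (intro ext dir_deriv_eq der)
  moreover have "Ck_on j UNIV (\<lambda>p. 2 * (f v \<bullet> f p) + - (2 * (f v \<bullet> z)))" for v
    by (intro Ck_on_add Ck_on_const Ck_on_linear bounded_linear_const_mult
        bounded_linear_inner_right_comp f)
  ultimately show ?thesis
    using Suc der by (auto simp: differentiable_def)
qed

section \<open>The curvature operator\<close>

lemma F_op_eq:
  "F_op (q, Y) = - (\<Sum>i\<in>UNIV. Y$i$i) + (\<Sum>i\<in>UNIV. \<Sum>j\<in>UNIV. q$i * q$j / (norm q)\<^sup>2 * Y$j$i)"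
proof -
  have "(\<Sum>k\<in>UNIV. (mat 1 - (1 / (norm q)\<^sup>2) *\<^sub>R tensor q q) $ i $ k * Y $ k $ i)
    = Y$i$i - (\<Sum>j\<in>UNIV. q$i * q$j / (norm q)\<^sup>2 * Y$j$i)" for i
    by (simp add: mat_def tensor_def left_diff_distrib sum_subtractf if_distrib[where f="\<lambda>x. x * _"]
        cong: if_cong)
  then show ?thesis
    by (simp add: F_op_def trace_def matrix_matrix_mult_def sum_subtractf)
qed

lemma F_op_minus: "F_op (q, Y) - F_op (q, X) = F_op (q, Y - X)"
  by (simp add: F_op_eq sum_subtractf right_diff_distrib)

text \<open>
  The entries of \<open>q \<otimes> q / |q|\<^sup>2\<close> are at most \<open>1\<close>, so \<open>F\<close> is Lipschitz in the matrix, uniformly in the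
  direction \<open>q\<close>; this survives the passage to the singular direction \<open>q = 0\<close>.
\<close>

lemma abs_F_op_le:
  fixes Z :: "real^'n^'n"
  shows "\<bar>F_op (q, Z)\<bar> \<le> (CARD('n) + CARD('n) * CARD('n)) * norm Z"
proof -
  have Z: "\<bar>Z$i$j\<bar> \<le> norm Z" for i j
    using component_le_norm_cart[of "Z$i" j] Finite_Cartesian_Product.norm_nth_le[of Z i] by linarith
  have 1: "\<bar>\<Sum>i\<in>UNIV. Z$i$i\<bar> \<le> CARD('n) * norm Z"
    by (rule order_trans[OF sum_abs]) (use sum_bounded_above[of UNIV "\<lambda>i. \<bar>Z$i$i\<bar>" "norm Z"] Z in auto)
  have c: "\<bar>q$i * q$j / (norm q)\<^sup>2 * Z$j$i\<bar> \<le> norm Z" for i j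
  proof (cases "q = 0")
    case False
    have "\<bar>q$i * q$j\<bar> \<le> norm q * norm q"
      unfolding abs_mult by (intro mult_mono component_le_norm_cart) auto
    then have "\<bar>q$i * q$j / (norm q)\<^sup>2\<bar> \<le> 1"
      using False by (simp add: field_simps power2_eq_square abs_mult)
    then have "\<bar>q$i * q$j / (norm q)\<^sup>2\<bar> * \<bar>Z$j$i\<bar> \<le> 1 * norm Z"
      using Z by (intro mult_mono) auto
    then show ?thesis by (simp add: abs_mult)
  qed simp
  have "\<bar>\<Sum>i\<in>UNIV. \<Sum>j\<in>UNIV. q$i * q$j / (norm q)\<^sup>2 * Z$j$i\<bar>
      \<le> (\<Sum>i::'n\<in>UNIV. \<Sum>j::'n\<in>UNIV. norm Z)"
    by (intro order_trans[OF sum_abs] sum_mono order_trans[OF sum_abs] c)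
  then have 2: "\<bar>\<Sum>i\<in>UNIV. \<Sum>j\<in>UNIV. q$i * q$j / (norm q)\<^sup>2 * Z$j$i\<bar> \<le> CARD('n) * CARD('n) * norm Z"
    by simp
  from 1 2 show ?thesis
    unfolding F_op_eq by (simp add: algebra_simps)
qed

text \<open>
  The rank-one part contributes \<open>- b\<close> times the squared distance from \<open>p\<close> to the line spanned by \<open>q\<close>,
  which is at most \<open>|p - q|\<^sup>2\<close>. This form of the bound is insensitive to whether \<open>p = 0\<close>.
\<close>

lemma F_op_rank_one:
  fixes p q :: "real^'n"
  assumes "q \<noteq> 0" "b \<ge> 0"
  shows "F_op (q, mat c + b *\<^sub>R tensor p p) \<ge> - c * (real CARD('n) - 1) - b * (norm (p - q))\<^sup>2"
proof -
  let ?X = "mat c + b *\<^sub>R tensor p p"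
  have tr: "(\<Sum>i\<in>UNIV. ?X$i$i) = c * CARD('n) + b * (p \<bullet> p)"
    by (simp add: mat_def tensor_def sum.distrib inner_vec_def sum_distrib_left)
  have r: "(\<Sum>j\<in>UNIV. q$i * q$j / (norm q)\<^sup>2 * ?X$j$i)
     = c * (q$i * q$i / (norm q)\<^sup>2) + b * (q$i * p$i * (p \<bullet> q) / (norm q)\<^sup>2)" for i
    by (simp add: mat_def tensor_def distrib_left sum.distrib inner_vec_def sum_distrib_left
       sum_divide_distrib if_distrib[where f="\<lambda>x. _ * x"] cong: if_cong)
      (auto intro!: sum.cong simp: field_simps)
  have q: "(\<Sum>i\<in>UNIV. q$i * q$i) = (norm q)\<^sup>2" "(\<Sum>i\<in>UNIV. q$i * p$i) = p \<bullet> q"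
    by (simp_all add: power2_norm_eq_inner inner_vec_def mult.commute)
  have "(\<Sum>i\<in>UNIV. \<Sum>j\<in>UNIV. q$i * q$j / (norm q)\<^sup>2 * ?X$j$i)
    = c * ((\<Sum>i\<in>UNIV. q$i * q$i) / (norm q)\<^sup>2) + b * ((\<Sum>i\<in>UNIV. q$i * p$i) * (p \<bullet> q) / (norm q)\<^sup>2)"
    unfolding r by (simp add: sum.distrib sum_distrib_left sum_divide_distrib sum_distrib_right)
  also have "\<dots> = c + b * ((p \<bullet> q)\<^sup>2 / (norm q)\<^sup>2)"
    using assms unfolding q by (simp add: power2_eq_square)
  finally have F: "F_op (q, ?X) = - c * (real CARD('n) - 1) - b * (p \<bullet> p - (p \<bullet> q)\<^sup>2 / (norm q)\<^sup>2)"
    unfolding F_op_eq tr by (simp add: algebra_simps)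
  \<comment> \<open>The difference is the squared distance from \<open>q\<close> to the projection of \<open>p\<close>, times \<open>|q|\<^sup>2\<close>.\<close>
  have "(norm q)\<^sup>2 * (norm (p - q))\<^sup>2 - ((norm q)\<^sup>2 * (p \<bullet> p) - (p \<bullet> q)\<^sup>2) = ((norm q)\<^sup>2 - p \<bullet> q)\<^sup>2"
    unfolding power2_norm_eq_inner by (simp add: algebra_simps power2_eq_square inner_commute)
  then have "(norm q)\<^sup>2 * (p \<bullet> p) - (p \<bullet> q)\<^sup>2 \<le> (norm q)\<^sup>2 * (norm (p - q))\<^sup>2"
    by (smt (verit) zero_le_power2)
  then have "p \<bullet> p - (p \<bullet> q)\<^sup>2 / (norm q)\<^sup>2 \<le> (norm (p - q))\<^sup>2"
    using assms by (simp add: field_simps)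
  from mult_left_mono[OF this assms(2)] show ?thesis
    unfolding F by linarith
qed

text \<open>
  Hessians of radial functions have this form, with \<open>p\<close> the gradient. The two
  preceding estimates give one continuous minorant of \<open>F\<close>, which handles \<open>p \<noteq> 0\<close> and the critical point
  \<open>p = 0\<close> at once.
\<close>

lemma F_lower_rank_one:
  fixes p :: "real^'n"
  assumes "b \<ge> 0"
  shows "F_lower p (mat c + b *\<^sub>R tensor p p) \<ge> ereal (- c * (real CARD('n) - 1))"
proof -
  let ?X = "mat c + b *\<^sub>R tensor p p"
  let ?C = "real (CARD('n) + CARD('n) * CARD('n))"
  let ?F = "inf (nhds (p, ?X)) (principal (F_dom :: ((real^'n) \<times> (real^'n^'n)) set))"
  let ?g = "\<lambda>(q, Y). - c * (real CARD('n) - 1) - b * (norm (p - q))\<^sup>2 - ?C * norm (Y - ?X)"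
  have "isCont ?g (p, ?X)"
    unfolding case_prod_unfold by (intro continuous_intros)
  then have "(?g \<longlongrightarrow> ?g (p, ?X)) (nhds (p, ?X))"
    by (simp only: isCont_def tendsto_at_iff_tendsto_nhds)
  then have lim: "(?g \<longlongrightarrow> - c * (real CARD('n) - 1)) ?F"
    by (auto intro: tendsto_mono[OF inf_le1])
  have ev: "\<forall>\<^sub>F y in ?F. ereal (?g y) \<le> ereal (F_op y)"
    unfolding eventually_inf_principal
  proof (intro always_eventually allI impI)
    fix y :: "(real^'n) \<times> (real^'n^'n)" assume "y \<in> F_dom"
    then obtain q Y where y: "y = (q, Y)" "q \<noteq> 0" by (auto simp: F_dom_def)
    show "ereal (?g y) \<le> ereal (F_op y)"
      using F_op_rank_one[OF y(2) assms, of c p] F_op_minus[of q Y ?X] abs_F_op_le[of q "Y - ?X"]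
      by (simp add: y(1))
  qed
  show ?thesis
  proof (cases "?F = bot")
    case True
    then show ?thesis by (simp add: F_lower_def lsc_env_def)
  next
    case False
    with lim have "Liminf ?F (\<lambda>y. ereal (?g y)) = ereal (- c * (real CARD('n) - 1))"
      by (intro lim_imp_Liminf tendsto_ereal)
    with Liminf_mono[OF ev] show ?thesis
      by (simp add: F_lower_def lsc_env_def)
  qed
qed

section \<open>Comparison with smooth strict supersolutions\<close>

lemma usc_env_eq:
  assumes "continuous_on S u" "p \<in> S"
  shows "usc_env S u p = ereal (u p)"
proof -
  let ?F = "inf (nhds p) (principal S)"
  have "(u \<longlongrightarrow> u p) ?F"
  proof (rule topological_tendstoI)
    fix B assume B: "open B" "u p \<in> B"
    with assms obtain A where "open A" "p \<in> A" "\<forall>y\<in>S. y \<in> A \<longrightarrow> u y \<in> B"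
      unfolding continuous_on_topological by metis
    then show "\<forall>\<^sub>F x in ?F. u x \<in> B"
      by (auto simp: eventually_inf_principal eventually_nhds)
  qed
  moreover have "?F \<noteq> bot"
    using assms(2) by (auto simp: trivial_limit_def eventually_inf_principal eventually_nhds)
  ultimately show ?thesis
    unfolding usc_env_def by (intro lim_imp_Limsup) auto
qed

lemma K_class_constant_far:
  assumes "u \<in> K_class a" "0 < T"
  obtains R where "\<And>x t. norm x \<ge> R \<Longrightarrow> 0 \<le> t \<Longrightarrow> t \<le> T \<Longrightarrow> u (x, t) = a"
proof -
  from assms obtain R where "\<forall>x t. norm x \<ge> R \<and> t \<in> {0..T} \<longrightarrow> u (x, t) = a"
    unfolding K_class_def by blast
  then show ?thesis by (intro that[of R]) auto
qed

text \<open>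
  If \<open>u\<close> exceeded \<open>\<phi>\<close> somewhere, then \<open>u - \<phi>\<close> would have a positive maximum, because \<open>u = a \<le> \<phi>\<close> near
  infinity. The bounds at times \<open>0\<close> and \<open>T\<close> put it at an interior time, and there
  \<open>u > \<phi> \<ge> \<Psi>m\<close>, so that the subsolution inequality applies to \<open>\<phi>\<close> and contradicts strictness.
\<close>

lemma subsolution_le_strict_supersolution:
  assumes sub: "viscosity_subsolution \<nu> \<Psi>m \<Psi>p u0 u" and K: "u \<in> K_class a" and "T > 0"
    and sm: "smooth_on UNIV \<phi>"
    and far: "\<And>x t. 0 \<le> t \<Longrightarrow> t \<le> T \<Longrightarrow> a \<le> \<phi> (x, t)"
    and init: "\<And>x. u (x, 0) \<le> \<phi> (x, 0)" and final: "\<And>x. u (x, T) \<le> \<phi> (x, T)"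
    and obst: "\<And>x t. 0 < t \<Longrightarrow> t < T \<Longrightarrow> \<Psi>m x \<le> \<phi> (x, t)"
    and strict: "\<And>x t. 0 < t \<Longrightarrow> t < T \<Longrightarrow>
        ereal (time_deriv \<phi> (x, t) - \<nu> * norm (space_grad \<phi> (x, t)))
          + F_lower (space_grad \<phi> (x, t)) (space_hess \<phi> (x, t)) > 0"
    and t: "0 \<le> t" "t \<le> T"
  shows "u (x, t) \<le> \<phi> (x, t)"
proof (rule ccontr)
  assume "\<not> u (x, t) \<le> \<phi> (x, t)"
  then have gt: "u (x, t) > \<phi> (x, t)" by simp
  from K have cont: "continuous_on space_time u"
    by (simp add: K_class_def)
  obtain R where R: "\<And>x t. norm x \<ge> R \<Longrightarrow> 0 \<le> t \<Longrightarrow> t \<le> T \<Longrightarrow> u (x, t) = a"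
    using K_class_constant_far[OF K \<open>T > 0\<close>] by blast
  let ?K = "cball (0 :: real^'a) R \<times> {0..T}"
  have "(x, t) \<in> ?K"
    using R[of x t] far[of t x] t gt by (cases "norm x \<ge> R") auto
  then have "?K \<noteq> {}" by blast
  moreover have "continuous_on ?K (\<lambda>q. u q - \<phi> q)"
    by (intro continuous_intros continuous_on_subset[OF cont]
        continuous_on_subset[OF smooth_on_imp_continuous_on[OF sm]]) (auto simp: space_time_def)
  moreover have "compact ?K" by (intro compact_Times) auto
  ultimately obtain p where "p \<in> ?K" "\<And>y. y \<in> ?K \<Longrightarrow> u y - \<phi> y \<le> u p - \<phi> p"
    using continuous_attains_sup[of ?K "\<lambda>q. u q - \<phi> q"] by blast
  then obtain x0 t0 where m: "(x0, t0) \<in> ?K"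
    "\<And>y. y \<in> ?K \<Longrightarrow> u y - \<phi> y \<le> u (x0, t0) - \<phi> (x0, t0)"
    by (cases p) blast
  have pos: "u (x0, t0) > \<phi> (x0, t0)"
    using m(2)[OF \<open>(x, t) \<in> ?K\<close>] gt by simp
  with m(1) init[of x0] final[of x0] have t0: "0 < t0" "t0 < T"
    by (auto simp: less_le)
  let ?us = "usc_env space_time u"
  have us: "?us y = ereal (u y)" if "0 \<le> snd y" for y
    using that by (intro usc_env_eq cont) (auto simp: space_time_def mem_Times_iff)
  have glob: "u y - \<phi> y \<le> u (x0, t0) - \<phi> (x0, t0)" if y: "y \<in> UNIV \<times> {0<..<T}" for y
  proof (cases "y \<in> ?K")
    case False
    with y have "u y = a" "a \<le> \<phi> y"
      using R[of "fst y" "snd y"] far[of "snd y" "fst y"] by (auto simp: mem_Times_iff)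
    with pos show ?thesis by simp
  qed (rule m)
  have "\<forall>\<^sub>F q in nhds (x0, t0). q \<in> UNIV \<times> {0<..<T}"
    using t0 by (intro eventually_nhds_in_open open_Times) auto
  then have "\<forall>\<^sub>F q in nhds (x0, t0). ?us q - ereal (\<phi> q) \<le> ?us (x0, t0) - ereal (\<phi> (x0, t0))"
  proof eventually_elim
    case (elim q)
    with glob[OF elim] us[of q] us[of "(x0, t0)"] t0 show ?case by (auto simp: mem_Times_iff)
  qed
  moreover have "?us (x0, t0) > ereal (\<Psi>m x0)"
    using us[of "(x0, t0)"] t0 pos obst[of t0 x0] by simp
  moreover have "smooth_on pos_time \<phi>"
    using sm by (rule smooth_on_subset) simp
  ultimately have "ereal (time_deriv \<phi> (x0, t0) - \<nu> * norm (space_grad \<phi> (x0, t0)))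
            + F_lower (space_grad \<phi> (x0, t0)) (space_hess \<phi> (x0, t0)) \<le> 0"
    using sub t0(1) unfolding viscosity_subsolution_def Let_def by blast
  with strict[OF t0, of x0] show False by simp
qed


section \<open>The shrinking ball barrier\<close>

text \<open>
  The first exponential has the ball of squared radius \<open>A - \<alpha> t\<close> around \<open>z\<close> as a superlevel set. The
  exponential, unlike a power of a positive part, is smooth across the boundary of the ball.
\<close>

definition ball_barrier :: "real \<Rightarrow> real \<Rightarrow> real \<Rightarrow> real \<Rightarrow> real \<Rightarrow> real^'n \<Rightarrow> (real^'n) \<times> real \<Rightarrow> real"
  where "ball_barrier k \<theta> A \<alpha> t1 z y =
    \<theta> + exp (k * (A - \<alpha> * snd y - (fst y - z) \<bullet> (fst y - z))) + exp (k * (snd y - t1))"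

lemma smooth_ball_barrier: "smooth_on UNIV (ball_barrier k \<theta> A \<alpha> t1 z)"
proof -
  have *: "ball_barrier k \<theta> A \<alpha> t1 z = (\<lambda>y. (\<theta> +
      exp (k * ((A + (- \<alpha>) * snd y) + (- 1) * ((fst y - z) \<bullet> (fst y - z))))) + exp (k * (snd y + - t1)))"
    by (auto simp: ball_barrier_def fun_eq_iff)
  show ?thesis unfolding smooth_on_def *
    by (intro allI Ck_on_add Ck_on_exp Ck_on_mult Ck_on_const Ck_on_norm_square
        Ck_on_linear bounded_linear_fst bounded_linear_snd)
qed

lemma dir_deriv_ball_barrier:
  "dir_deriv v (ball_barrier k \<theta> A \<alpha> t1 z) y =
    exp (k * (A - \<alpha> * snd y - (fst y - z) \<bullet> (fst y - z))) * (k * (- \<alpha> * snd v - 2 * ((fst y - z) \<bullet> fst v)))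
      + exp (k * (snd y - t1)) * (k * snd v)"
proof (rule dir_deriv_eq)
  show "(ball_barrier k \<theta> A \<alpha> t1 z has_derivative (\<lambda>v.
    exp (k * (A - \<alpha> * snd y - (fst y - z) \<bullet> (fst y - z))) * (k * (- \<alpha> * snd v - 2 * ((fst y - z) \<bullet> fst v)))
      + exp (k * (snd y - t1)) * (k * snd v))) (at y)"
    unfolding ball_barrier_def
    by (auto intro!: derivative_eq_intros simp: inner_commute algebra_simps)
qed

lemma dir_deriv_space_ball_barrier:
  "dir_deriv (w, 0) (dir_deriv (v, 0) (ball_barrier k \<theta> A \<alpha> t1 z)) y =
    exp (k * (A - \<alpha> * snd y - (fst y - z) \<bullet> (fst y - z))) *
      (4 * k\<^sup>2 * ((fst y - z) \<bullet> v) * ((fst y - z) \<bullet> w) - 2 * k * (v \<bullet> w))"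
proof -
  have *: "dir_deriv (v, 0) (ball_barrier k \<theta> A \<alpha> t1 z) = (\<lambda>y.
     exp (k * (A - \<alpha> * snd y - (fst y - z) \<bullet> (fst y - z))) * (- 2 * k * ((fst y - z) \<bullet> v)))"
    by (auto simp: dir_deriv_ball_barrier fun_eq_iff)
  have der: "(dir_deriv (v, 0) (ball_barrier k \<theta> A \<alpha> t1 z) has_derivative
    (\<lambda>h. exp (k * (A - \<alpha> * snd y - (fst y - z) \<bullet> (fst y - z))) * (- 2 * k * (fst h \<bullet> v)) +
     exp (k * (A - \<alpha> * snd y - (fst y - z) \<bullet> (fst y - z))) * (k * (- \<alpha> * snd h - 2 * ((fst y - z) \<bullet> fst h)))
      * (- 2 * k * ((fst y - z) \<bullet> v)))) (at y)"
    unfolding *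
    by (auto intro!: derivative_eq_intros simp: inner_commute algebra_simps)
  show ?thesis
    unfolding dir_deriv_eq[OF der] by (simp add: algebra_simps power2_eq_square inner_commute)
qed

text \<open>
  The Hessian is a multiple of the identity plus a multiple of the tensor square of the gradient.
  The spatial part is therefore at least \<open>2 k e (d - 1)\<close>, where \<open>e\<close> is the first exponential. It absorbs
  the term \<open>- k e \<alpha>\<close> of the time derivative, and the second exponential leaves a positive remainder.
\<close>

lemma ball_barrier_strict_supersolution:
  fixes z :: "real^'n" and k \<theta> A \<alpha> t1 :: real
  assumes "k > 0" "\<alpha> \<le> 2 * (real CARD('n) - 1)"
  defines "\<phi> \<equiv> ball_barrier k \<theta> A \<alpha> t1 z"
  shows "ereal (time_deriv \<phi> y) + F_lower (space_grad \<phi> y) (space_hess \<phi> y) > 0"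
proof -
  define e where "e = exp (k * (A - \<alpha> * snd y - (fst y - z) \<bullet> (fst y - z)))"
  have "e > 0" by (simp add: e_def)
  have td: "time_deriv \<phi> y = - k * e * \<alpha> + k * exp (k * (snd y - t1))"
    by (simp add: time_deriv_def \<phi>_def dir_deriv_ball_barrier e_def)
  define d where "d = fst y - z"
  have sg: "space_grad \<phi> y = (- 2 * k * e) *\<^sub>R d"
    by (simp add: vec_eq_iff space_grad_def \<phi>_def dir_deriv_ball_barrier e_def d_def inner_axis
        algebra_simps)
  have hess: "space_hess \<phi> y $ i $ j
      = e * (4 * k\<^sup>2 * d $ j * d $ i - 2 * k * (if i = j then 1 else 0))" for i j
    by (simp add: space_hess_def \<phi>_def dir_deriv_space_ball_barrier e_def d_def[symmetric] inner_axis)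
       (simp add: axis_def)
  have sh: "space_hess \<phi> y = mat (- 2 * k * e) + (1 / e) *\<^sub>R tensor (space_grad \<phi> y) (space_grad \<phi> y)"
    using \<open>e > 0\<close> unfolding sg
    by (auto simp: vec_eq_iff hess tensor_def mat_def power2_eq_square) (auto simp: algebra_simps)
  have "ereal (- (- 2 * k * e) * (real CARD('n) - 1)) \<le> F_lower (space_grad \<phi> y) (space_hess \<phi> y)"
    unfolding sh by (rule F_lower_rank_one) (use \<open>e > 0\<close> in simp)
  then have "ereal (time_deriv \<phi> y + 2 * k * e * (real CARD('n) - 1))
     \<le> ereal (time_deriv \<phi> y) + F_lower (space_grad \<phi> y) (space_hess \<phi> y)"
    by (simp flip: plus_ereal.simps(1) add: add_left_mono)
  moreover have "time_deriv \<phi> y + 2 * k * e * (real CARD('n) - 1) > 0"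
  proof -
    have "k * e * \<alpha> \<le> k * e * (2 * (real CARD('n) - 1))"
      using assms \<open>e > 0\<close> by (intro mult_left_mono) auto
    moreover have "k * exp (k * (snd y - t1)) > 0" using assms by simp
    ultimately show ?thesis unfolding td by (simp add: algebra_simps)
  qed
  ultimately show ?thesis
    by (metis ereal_less(2) less_le_trans)
qed

section \<open>Evolutions stay in shrinking balls\<close>

lemma exp_eventually_ge:
  fixes C \<delta> :: real
  assumes "\<delta> > 0"
  shows "\<forall>\<^sub>F k in at_top. exp (k * \<delta>) \<ge> C"
proof (rule eventually_mono[OF eventually_ge_at_top[of "C / \<delta>"]])
  fix k assume "C / \<delta> \<le> k"
  with assms have "C \<le> k * \<delta>" by (simp add: field_simps)
  also have "\<dots> \<le> exp (k * \<delta>)" using exp_ge_add_one_self[of "k * \<delta>"] by linarith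
  finally show "C \<le> exp (k * \<delta>)" .
qed

lemma K_class_bounded_above:
  assumes "u \<in> K_class a" "T > 0"
  obtains C where "\<And>x t. 0 \<le> t \<Longrightarrow> t \<le> T \<Longrightarrow> u (x, t) \<le> C"
proof -
  obtain R where R: "\<And>x t. norm x \<ge> R \<Longrightarrow> 0 \<le> t \<Longrightarrow> t \<le> T \<Longrightarrow> u (x, t) = a"
    using K_class_constant_far[OF assms] by blast
  let ?K = "cball (0 :: real^'a) R \<times> {0..T}"
  have "continuous_on ?K u"
    using assms by (auto simp: K_class_def space_time_def intro: continuous_on_subset)
  then have "compact (u ` ?K)"
    by (intro compact_continuous_image compact_Times) auto
  then obtain B where B: "\<And>q. q \<in> ?K \<Longrightarrow> \<bar>u q\<bar> \<le> B"
    using compact_imp_bounded bounded_iff by (metis image_eqI real_norm_def)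
  show ?thesis
  proof (rule that)
    fix x t assume "0 \<le> t" "t \<le> T"
    then show "u (x, t) \<le> max a B"
      using R[of x t] B[of "(x, t)"] by (cases "norm x \<ge> R") auto
  qed
qed

lemma obstacle_le:
  assumes "viscosity_subsolution \<nu> \<Psi>m \<Psi>p u0 u" "u \<in> K_class a" "t > 0"
  shows "\<Psi>m x \<le> u (x, t)"
proof -
  have "ereal (\<Psi>m x) \<le> usc_env space_time u (x, t)"
    using assms(1,3) by (auto simp: viscosity_subsolution_def Let_def)
  also have "\<dots> = ereal (u (x, t))"
    using assms by (intro usc_env_eq) (auto simp: K_class_def space_time_def)
  finally show ?thesis by simp
qed

text \<open>
  The strict inequalities \<open>A' < A\<close> and \<open>m < A - \<alpha> T\<close> keep the initial set and the obstacle inside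
  the moving ball with a gap. Across the gap the barrier grows exponentially in \<open>k\<close>, so it dominates
  the initial values and the obstacle for large \<open>k\<close> whatever their size.
\<close>

lemma superlevel_set_in_shrinking_ball:
  fixes z :: "real^'n" and u :: "(real^'n) \<times> real \<Rightarrow> real"
  assumes sub: "viscosity_subsolution 0 \<Psi>m \<Psi>p u0 u" and K: "u \<in> K_class a" and "a \<le> \<theta>"
    and \<alpha>: "0 \<le> \<alpha>" "\<alpha> \<le> 2 * (real CARD('n) - 1)"
    and obst: "\<And>x. \<Psi>m x > \<theta> \<Longrightarrow> (x - z) \<bullet> (x - z) \<le> m" and m: "m < A - \<alpha> * T"
    and init: "\<And>x. u (x, 0) > \<theta> \<Longrightarrow> (x - z) \<bullet> (x - z) \<le> A'" and A': "A' < A"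
    and t: "0 \<le> t" "t < T" and x: "(x - z) \<bullet> (x - z) > A - \<alpha> * t"
  shows "u (x, t) \<le> \<theta>"
proof -
  \<comment> \<open>Any time between \<open>t\<close> and \<open>T\<close>: as \<open>k\<close> grows, the second exponential vanishes at \<open>t\<close> and blows up at \<open>T\<close>.\<close>
  define t1 where "t1 = (t + T) / 2"
  have "T > 0" "t1 < T" "t < t1" using t by (auto simp: t1_def)
  obtain C where C: "\<And>x t. 0 \<le> t \<Longrightarrow> t \<le> T \<Longrightarrow> u (x, t) \<le> C"
    using K_class_bounded_above[OF K \<open>T > 0\<close>] by blast
  have "\<forall>\<^sub>F k in at_top. k > 0 \<and> exp (k * (A - A')) \<ge> C - \<theta> \<and>
      exp (k * (A - \<alpha> * T - m)) \<ge> C - \<theta> \<and> exp (k * (T - t1)) \<ge> C - \<theta>"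
    using A' m \<open>t1 < T\<close>
    by (intro eventually_conj eventually_gt_at_top exp_eventually_ge) auto
  then have ev: "\<forall>\<^sub>F k in at_top. u (x, t) \<le> ball_barrier k \<theta> A \<alpha> t1 z (x, t)"
  proof eventually_elim
    case (elim k)
    then have k: "k > 0" by simp
    have gt: "ball_barrier k \<theta> A \<alpha> t1 z (y, s) > \<theta>" for y s
      unfolding ball_barrier_def by (smt (verit) exp_gt_zero)
    have big: "C \<le> ball_barrier k \<theta> A \<alpha> t1 z (y, s)"
      if "exp (k * \<delta>) \<ge> C - \<theta>" "\<delta> \<le> A - \<alpha> * s - (y - z) \<bullet> (y - z) \<or> \<delta> \<le> s - t1" for y s \<delta>
      using that(2)
    proof
      assume "\<delta> \<le> A - \<alpha> * s - (y - z) \<bullet> (y - z)"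
      then have "exp (k * \<delta>) \<le> exp (k * (A - \<alpha> * s - (y - z) \<bullet> (y - z)))"
        using k by simp
      with that(1) exp_gt_zero[of "k * (s - t1)"] show ?thesis
        unfolding ball_barrier_def fst_conv snd_conv by linarith
    next
      assume "\<delta> \<le> s - t1"
      then have "exp (k * \<delta>) \<le> exp (k * (s - t1))"
        using k by simp
      with that(1) exp_gt_zero[of "k * (A - \<alpha> * s - (y - z) \<bullet> (y - z))"] show ?thesis
        unfolding ball_barrier_def fst_conv snd_conv by linarith
    qed
    show ?case
    proof (rule subsolution_le_strict_supersolution[OF sub K \<open>T > 0\<close> smooth_ball_barrier])
      show "a \<le> ball_barrier k \<theta> A \<alpha> t1 z (y, s)" for y s
        using gt[of y s] \<open>a \<le> \<theta>\<close> by linarith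
      show "u (y, 0) \<le> ball_barrier k \<theta> A \<alpha> t1 z (y, 0)" for y
      proof (cases "u (y, 0) > \<theta>")
        case True
        from init[OF True] elim have "C \<le> ball_barrier k \<theta> A \<alpha> t1 z (y, 0)"
          by (intro big[of "A - A'"]) auto
        with C[of 0 y] \<open>T > 0\<close> show ?thesis by linarith
      qed (use gt[of y 0] in linarith)
      show "u (y, T) \<le> ball_barrier k \<theta> A \<alpha> t1 z (y, T)" for y
        using big[of "T - t1" T y] elim C[of T y] \<open>T > 0\<close> by force
      show "\<Psi>m y \<le> ball_barrier k \<theta> A \<alpha> t1 z (y, s)" if s: "0 < s" "s < T" for y s
      proof (cases "\<Psi>m y > \<theta>")
        case True
        have "\<alpha> * s \<le> \<alpha> * T" using s \<alpha> by (intro mult_left_mono) auto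
        with obst[OF True] elim have "C \<le> ball_barrier k \<theta> A \<alpha> t1 z (y, s)"
          by (intro big[of "A - \<alpha> * T - m"]) auto
        with C[of s y] obstacle_le[OF sub K s(1), of y] s show ?thesis by linarith
      qed (use gt[of y s] in linarith)
      show "0 < ereal (time_deriv (ball_barrier k \<theta> A \<alpha> t1 z) (y, s) -
              0 * norm (space_grad (ball_barrier k \<theta> A \<alpha> t1 z) (y, s))) +
             F_lower (space_grad (ball_barrier k \<theta> A \<alpha> t1 z) (y, s))
              (space_hess (ball_barrier k \<theta> A \<alpha> t1 z) (y, s))" for y s
        using ball_barrier_strict_supersolution[OF k \<alpha>(2)] by simp
    qed (use t in auto)
  qed
  have "((\<lambda>k. exp (k * c)) \<longlongrightarrow> 0) at_top" if "c < 0" for c :: real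
  proof -
    have "LIM k at_top. c * k :> at_bot"
      using that by (intro filterlim_tendsto_neg_mult_at_bot[OF tendsto_const]) (auto simp: filterlim_ident)
    then show ?thesis
      by (auto intro!: filterlim_compose[OF exp_at_bot] simp: mult.commute)
  qed
  then have "((\<lambda>k. ball_barrier k \<theta> A \<alpha> t1 z (x, t)) \<longlongrightarrow> \<theta> + 0 + 0) at_top"
    unfolding ball_barrier_def fst_conv snd_conv
    using x \<open>t < t1\<close> by (intro tendsto_add tendsto_const) auto
  then have "((\<lambda>k. ball_barrier k \<theta> A \<alpha> t1 z (x, t)) \<longlongrightarrow> \<theta>) at_top" by simp
  from tendsto_lowerbound[OF this ev] show ?thesis by simp
qed

section \<open>Obstacles enclosed by balls\<close>

text \<open>
  The ball is the one at a frontier point \<open>w\<close> strictly between a point of \<open>K\<close> and \<open>x\<close>. Were \<open>x\<close> in the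
  closed ball, the open segment would run in the open ball, although \<open>w\<close> is on the sphere.
\<close>

lemma separating_ball:
  fixes K :: "'a::euclidean_space set"
  assumes "open K"
    and balls: "\<forall>w\<in>frontier K. \<exists>z\<in>ball w r. K \<subseteq> ball z (norm (z - w))"
    and "x \<notin> closure K" "K \<noteq> {}"
  obtains w z where "w \<in> frontier K" "z \<in> ball w r" "closure K \<subseteq> cball z (norm (z - w))" "x \<notin> cball z (norm (z - w))"
proof -
  obtain y where y: "y \<in> K" using assms by auto
  have "closed_segment y x \<inter> frontier K \<noteq> {}"
    using y assms(3) closure_subset[of K] by (intro connected_Int_frontier) auto
  then obtain w where w: "w \<in> closed_segment y x" "w \<in> frontier K" by auto
  with y assms(1,3) have "w \<in> open_segment y x"
    by (auto simp: open_segment_def frontier_def interior_open)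
  obtain z where z: "z \<in> ball w r" "K \<subseteq> ball z (norm (z - w))"
    using balls w by auto
  have "x \<notin> cball z (norm (z - w))"
  proof
    assume "x \<in> cball z (norm (z - w))"
    then have "open_segment y x \<subseteq> interior (cball z (norm (z - w)))"
      using y z by (intro in_interior_closure_convex_segment) (auto simp: closure_ball)
    with \<open>w \<in> open_segment y x\<close> show False
      by (auto simp: dist_norm)
  qed
  moreover have "closure K \<subseteq> cball z (norm (z - w))"
    using z by (intro closure_minimal) auto
  ultimately show ?thesis using that w z by blast
qed

text \<open>
  A frontier point of \<open>K\<close> lies on a sphere that bounds a closed ball around \<open>closure K\<close>, so it is not
  interior to \<open>closure K\<close>.
\<close>

lemma interior_closure_eq:
  fixes K :: "'a::euclidean_space set"
  assumes "open K"
    and balls: "\<forall>w\<in>frontier K. \<exists>z\<in>ball w r. K \<subseteq> ball z (norm (z - w))"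
  shows "interior (closure K) = K"
proof
  show "K \<subseteq> interior (closure K)"
    using assms(1) by (simp add: interior_maximal closure_subset)
  show "interior (closure K) \<subseteq> K"
  proof
    fix x assume x: "x \<in> interior (closure K)"
    show "x \<in> K"
    proof (rule ccontr)
      assume "x \<notin> K"
      with x assms(1) have "x \<in> frontier K"
        using interior_subset by (auto simp: frontier_def interior_open)
      with balls obtain z where "K \<subseteq> ball z (norm (z - x))" by auto
      then have "closure K \<subseteq> cball z (norm (z - x))"
        by (intro closure_minimal) auto
      then have "interior (closure K) \<subseteq> ball z (norm (z - x))"
        using interior_mono[of "closure K"] by (metis interior_cball)
      with x show False by (auto simp: dist_norm)
    qed
  qed
qed

section \<open>Extinction outside the obstacle\<close>

lemma negative_gap:
  fixes f :: "'a::euclidean_space \<Rightarrow> real"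
  assumes "continuous_on UNIV f" "closed S" "a < 0"
    and far: "\<And>x. norm x \<ge> R \<Longrightarrow> f x \<le> a" and neg: "\<And>x. x \<in> S \<Longrightarrow> f x < 0"
  obtains \<theta> where "a \<le> \<theta>" "\<theta> < 0" "\<And>x. x \<in> S \<Longrightarrow> f x \<le> \<theta>"
proof (cases "S \<inter> cball 0 R = {}")
  case True
  with far have "f x \<le> a" if "x \<in> S" for x using that by force
  with that[of a] assms(3) show ?thesis by auto
next
  case False
  have "compact (S \<inter> cball 0 R)" using assms(2) by (simp add: closed_Int_compact)
  then obtain p where p: "p \<in> S" "\<And>x. x \<in> S \<inter> cball 0 R \<Longrightarrow> f x \<le> f p"
    using continuous_attains_sup[OF _ False continuous_on_subset[OF assms(1)]] by blast
  show ?thesis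
  proof (rule that[of "max a (f p)"])
    show "f x \<le> max a (f p)" if "x \<in> S" for x
      using p(2)[of x] far[of x] that by (cases "norm x \<ge> R") auto
  qed (use assms(3) neg[OF p(1)] in auto)
qed


text \<open>
  The time \<open>t\<close> is arbitrary beyond \<open>A - m2\<close>: instead of stopping the ball at its final size, its speed is
  adapted to \<open>t\<close>, so that it reaches the squared radius \<open>m2\<close> exactly at time \<open>t\<close>.
\<close>

lemma superlevel_set_leaves_exterior:
  fixes z :: "real^'n" and u :: "(real^'n) \<times> real \<Rightarrow> real"
  assumes "CARD('n) \<ge> 2"
    and sub: "viscosity_subsolution 0 \<Psi>m \<Psi>p u0 u" and K: "u \<in> K_class a" and "a \<le> \<theta>"
    and obst: "\<And>x. \<Psi>m x > \<theta> \<Longrightarrow> (x - z) \<bullet> (x - z) \<le> m1"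
    and init: "\<And>x. u (x, 0) > \<theta> \<Longrightarrow> (x - z) \<bullet> (x - z) \<le> A'"
    and m: "m1 < m2" "m2 < (x - z) \<bullet> (x - z)" "m2 < A" "A' < A" and t: "0 < t" "A - m2 \<le> t"
  shows "u (x, t) \<le> \<theta>"
proof -
  define \<alpha> where "\<alpha> = (A - m2) / t"
  have \<alpha>: "0 \<le> \<alpha>" "\<alpha> \<le> 1" and mt: "A - \<alpha> * t = m2"
    using m t by (auto simp: \<alpha>_def field_simps)
  \<comment> \<open>The barrier has to live slightly longer than \<open>t\<close>. During the extra time \<open>\<eta>\<close> the squared
    radius loses at most \<open>\<eta>\<close> and remains above \<open>m1\<close>.\<close>
  define \<eta> where "\<eta> = (m2 - m1) / 2"
  have \<eta>: "0 < \<eta>" "m1 + \<eta> < m2" using m(1) by (auto simp: \<eta>_def field_simps)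
  have "\<alpha> * \<eta> \<le> 1 * \<eta>"
    using \<alpha> \<eta> by (intro mult_right_mono) auto
  show ?thesis
  proof (rule superlevel_set_in_shrinking_ball[OF sub K \<open>a \<le> \<theta>\<close> \<alpha>(1) _ obst _ init])
    have "2 \<le> real CARD('n)" using assms(1) by simp
    then have "1 \<le> 2 * (real CARD('n) - 1)" by simp
    with \<alpha>(2) show "\<alpha> \<le> 2 * (real CARD('n) - 1)" by (rule order_trans)
    show "m1 < A - \<alpha> * (t + \<eta>)"
      using \<open>\<alpha> * \<eta> \<le> 1 * \<eta>\<close> mt \<eta>(2) unfolding distrib_left by linarith
  qed (use m t mt \<eta> in auto)
qed

text \<open>
  The squared radii \<open>m1 < m2\<close> leave room between the obstacle \<open>K\<close> and \<open>x\<close>. The bounds in terms of \<open>B\<close> and \<open>r\<close>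
  do not depend on \<open>x\<close>, and this is what makes the extinction time uniform. For empty \<open>K\<close> every centre
  will do, and negative \<open>m1\<close> and \<open>m2\<close> describe empty balls.
\<close>

lemma exterior_point_ball:
  fixes K :: "'a::euclidean_space set"
  assumes "open K" "K \<subseteq> G" and G: "G \<subseteq> cball 0 B" and "0 \<le> B" "0 < r"
    and balls: "\<forall>w\<in>frontier K. \<exists>z\<in>ball w r. K \<subseteq> ball z (norm (z - w))"
    and x: "x \<notin> closure K"
  obtains z m1 m2 where "- 1 \<le> m1" "m1 < m2" "m2 < (x - z) \<bullet> (x - z)" "m2 < (2 * B + r)\<^sup>2 + 1"
    "\<And>y. y \<in> closure K \<Longrightarrow> (y - z) \<bullet> (y - z) < m1"
    "\<And>y. y \<in> closure G \<Longrightarrow> (y - z) \<bullet> (y - z) \<le> (2 * B + r)\<^sup>2"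
proof -
  have sq: "(v \<bullet> v \<le> c\<^sup>2) = (norm v \<le> c)" "(c\<^sup>2 < v \<bullet> v) = (c < norm v)" if "0 \<le> c" for v :: 'a and c
    using that norm_le_square norm_gt_square by auto
  have clG: "norm y \<le> B" if "y \<in> closure G" for y
  proof -
    have "closure G \<subseteq> cball 0 B" using G by (intro closure_minimal) auto
    with that show ?thesis by auto
  qed
  show ?thesis
  proof (cases "K = {}")
    case True
    show ?thesis
    proof (rule that[of "- 1" "- 1 / 2" 0])
      show "(y - 0) \<bullet> (y - 0) \<le> (2 * B + r)\<^sup>2" if "y \<in> closure G" for y
        using clG[OF that] assms(4,5) by (subst sq) auto
      have "0 \<le> (x - 0) \<bullet> (x - 0)" by (rule inner_ge_zero)
      then show "- 1 / 2 < (x - 0) \<bullet> (x - 0)" by linarith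
      have "0 \<le> (2 * B + r)\<^sup>2" by (rule zero_le_power2)
      then show "- 1 / 2 < (2 * B + r)\<^sup>2 + 1" by linarith
    qed (use True in auto)
  next
    case False
    obtain w z where wz: "w \<in> frontier K" "z \<in> ball w r" "closure K \<subseteq> cball z (norm (z - w))"
      "x \<notin> cball z (norm (z - w))"
      using separating_ball[OF assms(1) balls x False] by blast
    let ?\<rho> = "norm (z - w)"
    have "w \<in> closure G"
      using wz(1) closure_mono[OF assms(2)] by (auto simp: frontier_def)
    have "norm z \<le> B + r"
      using clG[OF \<open>w \<in> closure G\<close>] wz(2) norm_triangle_ineq[of w "z - w"]
      by (auto simp: dist_norm norm_minus_commute)
    have "?\<rho>\<^sup>2 < (2 * B + r)\<^sup>2 + 1"
    proof -
      have "?\<rho>\<^sup>2 \<le> (2 * B + r)\<^sup>2"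
        using wz(2) assms(4,5) by (intro power_mono) (auto simp: dist_norm norm_minus_commute)
      then show ?thesis by simp
    qed
    moreover have "?\<rho>\<^sup>2 < (x - z) \<bullet> (x - z)"
      using wz(4) by (subst sq) (auto simp: dist_norm norm_minus_commute)
    ultimately have "?\<rho>\<^sup>2 < min ((x - z) \<bullet> (x - z)) ((2 * B + r)\<^sup>2 + 1)" by simp
    then obtain m2 where m2: "?\<rho>\<^sup>2 < m2" "m2 < min ((x - z) \<bullet> (x - z)) ((2 * B + r)\<^sup>2 + 1)"
      using dense by blast
    then obtain m1 where m1: "?\<rho>\<^sup>2 < m1" "m1 < m2" using dense by blast
    show ?thesis
    proof (rule that[of m1 m2 z])
      show "- 1 \<le> m1" using m1(1) by (smt (verit) zero_le_power2)
      show "(y - z) \<bullet> (y - z) < m1" if "y \<in> closure K" for y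
      proof -
        have "(y - z) \<bullet> (y - z) \<le> ?\<rho>\<^sup>2"
          using that wz(3) by (subst sq) (auto simp: dist_norm norm_minus_commute)
        with m1 show ?thesis by simp
      qed
      show "(y - z) \<bullet> (y - z) \<le> (2 * B + r)\<^sup>2" if "y \<in> closure G" for y
        using clG[OF that] \<open>norm z \<le> B + r\<close> norm_triangle_ineq4[of y z] assms(4,5) by (subst sq) auto
    qed (use m1 m2 in auto)
  qed
qed

lemma has_set_limit_eventually_const:
  assumes "0 < \<tau>" "\<And>t. t \<ge> \<tau> \<Longrightarrow> D t = L"
  shows "has_set_limit D L"
proof -
  have "set_limsup D \<subseteq> L"
  proof
    fix x assume "x \<in> set_limsup D"
    with assms(1) have "x \<in> (\<Union>t\<in>{\<tau><..}. D t)"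
      unfolding set_limsup_def by blast
    with assms(2) show "x \<in> L" by auto
  qed
  moreover have "L \<subseteq> set_limsup D"
  proof
    fix x assume x: "x \<in> L"
    have "x \<in> (\<Union>t\<in>{s<..}. D t)" for s
      using x assms(2)[of "max s \<tau> + 1"] by (intro UN_I[of "max s \<tau> + 1"]) auto
    then show "x \<in> set_limsup D" by (auto simp: set_limsup_def)
  qed
  moreover have "set_liminf D \<subseteq> L"
  proof
    fix x assume "x \<in> set_liminf D"
    then obtain s where "x \<in> (\<Inter>t\<in>{s<..}. D t)" unfolding set_liminf_def by blast
    then have "x \<in> D (max s \<tau> + 1)" by auto
    with assms(2)[of "max s \<tau> + 1"] show "x \<in> L" by auto
  qed
  moreover have "L \<subseteq> set_liminf D"
    unfolding set_liminf_def using assms by (intro subsetI UN_I[of \<tau>]) auto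
  ultimately show ?thesis by (auto simp: has_set_limit_def)
qed

text \<open>
  With \<open>A = (2 B + r)\<^sup>2 + 1\<close> and \<open>m2 > -1\<close>, the waiting time \<open>A - m2\<close> of
  \<open>superlevel_set_leaves_exterior\<close> is at most \<open>(2 B + r)\<^sup>2 + 2\<close> for every exterior point.
\<close>

lemma open_evolution_reaches_obstacle:
  fixes Om D0 :: "(real^'n) set"
  assumes "CARD('n) \<ge> 2" and ev: "open_evolution 0 D0 Om UNIV D"
    and "Om \<subseteq> D0" and B: "D0 \<subseteq> cball 0 B" "0 \<le> B" and "0 < r"
    and balls: "\<forall>w\<in>frontier Om. \<exists>z\<in>ball w r. Om \<subseteq> ball z (norm (z - w))"
    and t: "(2 * B + r)\<^sup>2 + 2 \<le> t"
  shows "D t = Om"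
proof -
  have "0 < t" using t by (smt (verit) zero_le_power2)
  from ev have Om: "open Om" and D: "open (D t)" "Om \<subseteq> D t" and "D 0 = D0"
    using \<open>0 < t\<close> by (auto simp: open_evolution_def)
  from ev obtain \<Psi>m \<Psi>p u u0 a where K: "a < 0" "u \<in> K_class a"
    and sub: "viscosity_subsolution 0 \<Psi>m \<Psi>p u0 u"
    and Om': "Om = {x. \<Psi>m x > 0}" and Dt: "\<And>t. t \<ge> 0 \<Longrightarrow> D t = {x. u (x, t) > 0}"
    unfolding open_evolution_def level_set_data_def viscosity_solution_def by blast
  have "D t \<subseteq> closure Om"
  proof (rule ccontr)
    assume "\<not> D t \<subseteq> closure Om"
    then obtain x where x: "x \<in> D t" "x \<notin> closure Om" by auto
    obtain z m1 m2 where z: "- 1 \<le> m1" "m1 < m2" "m2 < (x - z) \<bullet> (x - z)" "m2 < (2 * B + r)\<^sup>2 + 1"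
      "\<And>y. y \<in> closure Om \<Longrightarrow> (y - z) \<bullet> (y - z) < m1"
      "\<And>y. y \<in> closure D0 \<Longrightarrow> (y - z) \<bullet> (y - z) \<le> (2 * B + r)\<^sup>2"
      by (rule exterior_point_ball[OF Om \<open>Om \<subseteq> D0\<close> B \<open>0 < r\<close> balls x(2)]) (rule that)
    have "u (x, t) \<le> 0"
    proof (rule superlevel_set_leaves_exterior[OF assms(1) sub K(2) _ _ _ z(2,3,4)])
      show "(y - z) \<bullet> (y - z) \<le> m1" if "\<Psi>m y > 0" for y
        using that z(5)[of y] closure_subset[of Om] by (auto simp: Om')
      show "(y - z) \<bullet> (y - z) \<le> (2 * B + r)\<^sup>2" if "u (y, 0) > 0" for y
        using that z(6)[of y] closure_subset[of D0] Dt[of 0] \<open>D 0 = D0\<close> by auto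
    qed (use K t \<open>0 < t\<close> z(1,2) in auto)
    with x Dt[of t] \<open>0 < t\<close> show False by auto
  qed
  with D(1) have "D t \<subseteq> interior (closure Om)" by (simp add: interior_maximal)
  with D(2) interior_closure_eq[OF Om balls] show ?thesis by auto
qed

lemma closed_evolution_reaches_obstacle:
  fixes Om D0 :: "(real^'n) set"
  assumes "CARD('n) \<ge> 2" and ev: "closed_evolution 0 (closure D0) (closure Om) UNIV E"
    and "open Om" "Om \<subseteq> D0" and B: "D0 \<subseteq> cball 0 B" "0 \<le> B" and "0 < r"
    and balls: "\<forall>w\<in>frontier Om. \<exists>z\<in>ball w r. Om \<subseteq> ball z (norm (z - w))"
    and t: "(2 * B + r)\<^sup>2 + 2 \<le> t"
  shows "E t = closure Om"
proof -
  have "0 < t" using t by (smt (verit) zero_le_power2)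
  from ev have E: "closure Om \<subseteq> E t" and "E 0 = closure D0"
    using \<open>0 < t\<close> by (auto simp: closed_evolution_def)
  from ev obtain \<Psi>m \<Psi>p u u0 a L where K: "a < 0" "u \<in> K_class a"
    and L: "L-lipschitz_on UNIV \<Psi>m"
    and sub: "viscosity_subsolution 0 \<Psi>m \<Psi>p u0 u"
    and Om': "closure Om = {x. \<Psi>m x \<ge> 0}" and Et: "\<And>t. t \<ge> 0 \<Longrightarrow> E t = {x. u (x, t) \<ge> 0}"
    unfolding closed_evolution_def level_set_data_def viscosity_solution_def by blast
  obtain R where R: "\<And>x t. norm x \<ge> R \<Longrightarrow> 0 \<le> t \<Longrightarrow> t \<le> 1 \<Longrightarrow> u (x, t) = a"
    using K_class_constant_far[OF K(2), of 1] by auto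
  have "E t \<subseteq> closure Om"
  proof (rule ccontr)
    assume "\<not> E t \<subseteq> closure Om"
    then obtain x where x: "x \<in> E t" "x \<notin> closure Om" by auto
    obtain z m1 m2 where z: "- 1 \<le> m1" "m1 < m2" "m2 < (x - z) \<bullet> (x - z)" "m2 < (2 * B + r)\<^sup>2 + 1"
      "\<And>y. y \<in> closure Om \<Longrightarrow> (y - z) \<bullet> (y - z) < m1"
      "\<And>y. y \<in> closure D0 \<Longrightarrow> (y - z) \<bullet> (y - z) \<le> (2 * B + r)\<^sup>2"
      by (rule exterior_point_ball[OF assms(3) \<open>Om \<subseteq> D0\<close> B \<open>0 < r\<close> balls x(2)]) (rule that)
    \<comment> \<open>Away from the ball around \<open>z\<close>, both the obstacle function and the initial values are
      bounded by negative constants; the larger constant is the level of comparison.\<close>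
    have cl: "closed {y. c \<le> (y - z) \<bullet> (y - z)}" for c
      by (intro closed_Collect_le continuous_intros)
    obtain \<theta>1 where \<theta>1: "a \<le> \<theta>1" "\<theta>1 < 0" "\<And>y. m1 \<le> (y - z) \<bullet> (y - z) \<Longrightarrow> \<Psi>m y \<le> \<theta>1"
    proof (rule negative_gap[OF lipschitz_on_continuous_on[OF L] cl[of m1] K(1)])
      show "\<Psi>m y \<le> a" if "norm y \<ge> R" for y
        using obstacle_le[OF sub K(2), of 1 y] R[OF that, of 1] by simp
      show "\<Psi>m y < 0" if "y \<in> {y. m1 \<le> (y - z) \<bullet> (y - z)}" for y
        using that z(5)[of y] Om' by (auto simp: not_less[symmetric])
    qed auto
    \<comment> \<open>Strictly between the squared radius containing \<open>closure D0\<close> and the initial squared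
      radius of the moving ball.\<close>
    define A' where "A' = (2 * B + r)\<^sup>2 + 1 / 2"
    have "continuous_on space_time u"
      using K(2) by (simp add: K_class_def)
    then have "continuous_on UNIV (\<lambda>y. u (y, 0))"
      by (rule continuous_on_compose2) (auto simp: space_time_def intro!: continuous_intros)
    then obtain \<theta>2 where \<theta>2: "a \<le> \<theta>2" "\<theta>2 < 0" "\<And>y. A' \<le> (y - z) \<bullet> (y - z) \<Longrightarrow> u (y, 0) \<le> \<theta>2"
    proof (rule negative_gap[OF _ cl[of A'] K(1)])
      show "u (y, 0) \<le> a" if "norm y \<ge> R" for y
        using R[OF that, of 0] by simp
      show "u (y, 0) < 0" if "y \<in> {y. A' \<le> (y - z) \<bullet> (y - z)}" for y
        using that z(6)[of y] Et[of 0] \<open>E 0 = closure D0\<close> by (auto simp: A'_def not_less[symmetric])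
    qed auto
    have "u (x, t) \<le> max \<theta>1 \<theta>2"
    proof (rule superlevel_set_leaves_exterior[OF assms(1) sub K(2) _ _ _ z(2,3,4)])
      show "(y - z) \<bullet> (y - z) \<le> m1" if "\<Psi>m y > max \<theta>1 \<theta>2" for y
        using that \<theta>1(3)[of y] by linarith
      show "(y - z) \<bullet> (y - z) \<le> A'" if "u (y, 0) > max \<theta>1 \<theta>2" for y
        using that \<theta>2(3)[of y] by linarith
    qed (use \<theta>1 t \<open>0 < t\<close> z(1,2) in \<open>auto simp: A'_def\<close>)
    with x Et[of t] \<open>0 < t\<close> \<theta>1(2) \<theta>2(2) show False by auto
  qed
  with E show ?thesis by auto
qed

theorem theorem3p7:
  fixes D E :: "real \<Rightarrow> (real^'n) set" and D0 Om :: "(real^'n) set"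
  assumes "CARD('n) \<ge> 2"
    and "open Om" and "open D0" and "Om \<subseteq> D0" and "bounded D0"
    and "open_evolution 0 D0 Om UNIV D"
    and "closed_evolution 0 (closure D0) (closure Om) UNIV E"
    and "\<exists>r>0. \<forall>w\<in>frontier Om. \<exists>z\<in>ball w r. Om \<subseteq> ball z (norm (z - w))"
  shows "has_set_limit D Om \<and> has_set_limit E (closure Om) \<and>
    (\<exists>\<tau>>0. \<forall>t\<ge>\<tau>. D t = D \<tau> \<and> D \<tau> = Om \<and> E t = E \<tau> \<and> E \<tau> = closure Om)"
proof -
  obtain r where r: "0 < r" "\<forall>w\<in>frontier Om. \<exists>z\<in>ball w r. Om \<subseteq> ball z (norm (z - w))"
    using assms(8) by blast
  obtain B where B: "D0 \<subseteq> cball 0 B" "0 \<le> B"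
    using assms(5) bounded_pos[of D0] by (auto simp: subset_iff dest: less_imp_le)
  define \<tau> where "\<tau> = (2 * B + r)\<^sup>2 + 2"
  have "\<tau> > 0" unfolding \<tau>_def by (smt (verit) zero_le_power2)
  have D: "D t = Om" if "t \<ge> \<tau>" for t
    using open_evolution_reaches_obstacle[OF assms(1,6,4) B r] that by (simp add: \<tau>_def)
  have E: "E t = closure Om" if "t \<ge> \<tau>" for t
    using closed_evolution_reaches_obstacle[OF assms(1,7,2,4) B r] that by (simp add: \<tau>_def)
  show ?thesis
    using \<open>\<tau> > 0\<close> D E by (auto intro!: has_set_limit_eventually_const[of \<tau>] exI[of _ \<tau>])
qed

end
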